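(* Let $w,v,w',v'\in\Sigma^\ast$ with $\mathrm{alph}(w)=\mathrm{alph}(v)$, $\mathrm{alph}(w')=\mathrm{alph}(v')$ and $\mathrm{alph}(w)\cap\mathrm{alph}(w')=\emptyset$. If $|w|_a=|v|_a$ for all $a\in\mathrm{alph}(w)$ and $|w'|_b=|v'|_b$ for all $b\in\mathrm{alph}(w')$, then the join $G(w,v)\nabla G(w',v')$ equals $G(ww',vv')$.
   Context: $\Sigma$ is a finite alphabet; $\mathrm{alph}(w)$ is the set of letters occurring in $w$ and $|w|_a$ the number of occurrences of $a$ in $w$. For letters $a,b$, $\pi_{a,b}$ is the monoid morphism on $\Sigma^\ast$ with $a\mapsto a$, $b\mapsto b$ and all other letters mapped to the empty word. For words $w,v$ with $\mathrm{alph}(w)=\mathrm{alph}(v)=A$, $G(w,v)$ is the undirected simple graph on vertex set $A$ in which distinct $a,b$ are adjacent iff $\pi_{a,b}(w)=\pi_{a,b}(v)$. For graphs $G=(V,E)$, $G'=(V',E')$ with disjoint vertex sets, the join $G\nabla G'$ has vertex set $V\cup V'$ and edge set $E\cup E'\cup\{\{u,u'\}: u\in V, u'\in V'\}$. *)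

theory Defs
  imports Main
begin

text \<open>
  Words over an alphabet \<open>\<Sigma>\<close> are lists in \<open>lists \<Sigma>\<close>; \<open>alph w\<close> is \<open>set w\<close> and the number of
  occurrences of \<open>a\<close> in \<open>w\<close> is \<open>count_list w a\<close>.
  An undirected simple graph is a pair of a vertex set and a set of two-element sets of vertices.
\<close>

type_synonym 'a ugraph = "'a set \<times> 'a set set"

definition proj2 :: "'a \<Rightarrow> 'a \<Rightarrow> 'a list \<Rightarrow> 'a list" where
  "proj2 a b w = concat (map (\<lambda>c. if c = a then [a] else if c = b then [b] else []) w)"

lemma proj2_Nil: "proj2 a b [] = []"
  by (simp add: proj2_def)

lemma proj2_append: "proj2 a b (u @ w) = proj2 a b u @ proj2 a b w"
  by (simp add: proj2_def)

lemma proj2_commute: "proj2 a b w = proj2 b a w"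
  unfolding proj2_def by (rule arg_cong[where f = concat]) auto

text \<open>Only meaningful if \<open>set w = set v\<close>, in which case this common set is the vertex set.\<close>

definition proj_graph :: "'a list \<Rightarrow> 'a list \<Rightarrow> 'a ugraph" where
  "proj_graph w v =
     (set w, {{a, b} | a b. a \<in> set w \<and> b \<in> set w \<and> a \<noteq> b \<and> proj2 a b w = proj2 a b v})"

text \<open>Only meaningful for graphs with disjoint vertex sets.\<close>

definition graph_join :: "'a ugraph \<Rightarrow> 'a ugraph \<Rightarrow> 'a ugraph" (infixl \<open>\<nabla>\<close> 65) where
  "G \<nabla> G' =
     (fst G \<union> fst G', snd G \<union> snd G' \<union> {{u, u'} | u u'. u \<in> fst G \<and> u' \<in> fst G'})"

end

theory Submission
  imports Defs
begin

text \<open>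
  If \<open>a\<close> and \<open>b\<close> both occur in \<open>w\<close>, then the projection to \<open>{a, b}\<close> erases \<open>w'\<close> and \<open>v'\<close>, and
  symmetrically if both occur in \<open>w'\<close>. If \<open>a\<close> occurs in \<open>w\<close> and \<open>b\<close> in \<open>w'\<close>, then the projections
  of \<open>ww'\<close> and \<open>vv'\<close> are both of the form \<open>a\<^sup>mb\<^sup>n\<close>, and the exponents agree because the
  numbers of occurrences do.
\<close>

lemma proj2_eq_Nil:
  assumes "a \<notin> set w" and "b \<notin> set w"
  shows "proj2 a b w = []"
  using assms by (induction w) (auto simp: proj2_def)

text \<open>Only the copies of \<open>a\<close> survive, so the projection depends on
  \<open>w\<close> through a single count. This is how the hypotheses on letter counts
  enter.\<close>

lemma proj2_eq_replicate:
  assumes "b \<notin> set w"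
  shows "proj2 a b w = replicate (count_list w a) a"
  using assms by (induction w) (auto simp: proj2_def)

text \<open>An equivalence, since each inclusion between the edge sets uses one direction.\<close>

lemma proj2_append_eq_of_mem_left:
  assumes "set w = set v" and "set w' = set v'" and "set w \<inter> set w' = {}"
    and "a \<in> set w" and "b \<in> set w"
  shows "proj2 a b (w @ w') = proj2 a b (v @ v') \<longleftrightarrow> proj2 a b w = proj2 a b v"
proof -
  have "proj2 a b w' = []" and "proj2 a b v' = []"
    using assms by (auto intro!: proj2_eq_Nil)
  then show ?thesis by (simp add: proj2_append)
qed

lemma proj2_append_eq_of_mem_right:
  assumes "set w = set v" and "set w' = set v'" and "set w \<inter> set w' = {}"
    and "a \<in> set w'" and "b \<in> set w'"
  shows "proj2 a b (w @ w') = proj2 a b (v @ v') \<longleftrightarrow> proj2 a b w' = proj2 a b v'"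
proof -
  have "proj2 a b w = []" and "proj2 a b v = []"
    using assms by (auto intro!: proj2_eq_Nil)
  then show ?thesis by (simp add: proj2_append)
qed

lemma proj2_append_eq_of_mem_both:
  assumes "set w = set v" and "set w' = set v'" and "set w \<inter> set w' = {}"
    and "count_list w a = count_list v a" and "count_list w' b = count_list v' b"
    and "a \<in> set w" and "b \<in> set w'"
  shows "proj2 a b (w @ w') = proj2 a b (v @ v')"
proof -
  have "b \<notin> set w" "b \<notin> set v" "a \<notin> set w'" "a \<notin> set v'"
    using assms by auto
  \<comment> \<open>In \<open>w'\<close> and \<open>v'\<close> the surviving letter is
    \<open>b\<close>, so the arguments are swapped to fit \<open>proj2_eq_replicate\<close>;
    \<open>proj2_commute\<close> undoes the swap below.\<close>
  then have "proj2 a b w = proj2 a b v" and "proj2 b a w' = proj2 b a v'"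
    using assms by (simp_all add: proj2_eq_replicate)
  then show ?thesis
    by (simp add: proj2_append proj2_commute[of a b w'] proj2_commute[of a b v'])
qed

theorem theorem10:
  fixes \<Sigma> :: "'a set" and w v w' v' :: "'a list"
  assumes "finite \<Sigma>"
    and "w \<in> lists \<Sigma>" and "v \<in> lists \<Sigma>" and "w' \<in> lists \<Sigma>" and "v' \<in> lists \<Sigma>"
    and "set w = set v" and "set w' = set v'" and "set w \<inter> set w' = {}"
    and "\<forall>a \<in> set w. count_list w a = count_list v a"
    and "\<forall>b \<in> set w'. count_list w' b = count_list v' b"
  shows "proj_graph w v \<nabla> proj_graph w' v' = proj_graph (w @ w') (v @ v')"
proof -
  note disj = assms(6-8)
  have mixed: "proj2 a b (w @ w') = proj2 a b (v @ v')" if "a \<in> set w" "b \<in> set w'" for a b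
    using proj2_append_eq_of_mem_both[OF disj] assms(9,10) that by blast
  let ?E = "{{a, b} | a b. a \<in> set w \<and> b \<in> set w \<and> a \<noteq> b \<and> proj2 a b w = proj2 a b v}"
  let ?E' = "{{a, b} | a b. a \<in> set w' \<and> b \<in> set w' \<and> a \<noteq> b \<and> proj2 a b w' = proj2 a b v'}"
  let ?J = "{{a, b} | a b. a \<in> set w \<and> b \<in> set w'}"
  let ?F = "{{a, b} | a b. a \<in> set (w @ w') \<and> b \<in> set (w @ w') \<and> a \<noteq> b
    \<and> proj2 a b (w @ w') = proj2 a b (v @ v')}"
  have "?E \<subseteq> ?F"
    using proj2_append_eq_of_mem_left[OF disj] by fastforce
  moreover have "?E' \<subseteq> ?F"
    using proj2_append_eq_of_mem_right[OF disj] by fastforce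
  \<comment> \<open>Disjointness of the alphabets gives \<open>a \<noteq> b\<close>, which
    \<open>?F\<close> demands and \<open>?J\<close> does not state.\<close>
  moreover have "?J \<subseteq> ?F"
    using mixed assms(8) by fastforce
  moreover have "?F \<subseteq> ?E \<union> ?E' \<union> ?J"
  proof
    fix e assume "e \<in> ?F"
    then obtain a b where e: "e = {a, b}" and "a \<noteq> b"
      and ab: "a \<in> set w \<or> a \<in> set w'" "b \<in> set w \<or> b \<in> set w'"
      and eq: "proj2 a b (w @ w') = proj2 a b (v @ v')"
      by auto
    consider "a \<in> set w" "b \<in> set w" | "a \<in> set w'" "b \<in> set w'"
      | "a \<in> set w" "b \<in> set w'" | "b \<in> set w" "a \<in> set w'"
      using ab by blast
    then show "e \<in> ?E \<union> ?E' \<union> ?J"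
    proof cases
      case 1
      then have "e \<in> ?E"
        using proj2_append_eq_of_mem_left[OF disj] e eq \<open>a \<noteq> b\<close> by blast
      then show ?thesis by blast
    next
      case 2
      then have "e \<in> ?E'"
        using proj2_append_eq_of_mem_right[OF disj] e eq \<open>a \<noteq> b\<close> by blast
      then show ?thesis by blast
    next
      case 3
      then show ?thesis using e by blast
    next
      case 4
      \<comment> \<open>Edges are unordered, so \<open>e\<close> is read as \<open>{b, a}\<close> to
        put the endpoint from \<open>w\<close> first.\<close>
      then have "e \<in> ?J" using e by (auto simp: doubleton_eq_iff)
      then show ?thesis by blast
    qed
  qed
  ultimately have "?E \<union> ?E' \<union> ?J = ?F"
    by (intro equalityI Un_least)
  then show ?thesis
    by (simp add: proj_graph_def graph_join_def)
qed

end
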